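(* For all positive integers $s$ and $k$, $$m_{\mathcal{A}_s}(k)=s \cdot m_\mathcal{A}(k)-s+1.$$
   Context: An axis-parallel strip is a set $\{(x,y)\in\mathbb{R}^2: x_0<x<x_1\}$ or $\{(x,y)\in\mathbb{R}^2: y_0<y<y_1\}$. The family $\mathcal{A}$ consists of hypergraphs $H=(V,E)$ with $V\subset\mathbb{R}^2$ finite and every edge of the form $V\cap A$ for an axis-parallel strip $A$. The family $\mathcal{A}_s$ consists of hypergraphs $H=(V,E)$ with $V\subset\mathbb{R}^2$ finite and every edge of the form $V\cap(A_1\cup\dots\cup A_s)$ for axis-parallel strips $A_1,\dots,A_s$. A polychromatic $k$-coloring of a hypergraph is a coloring of its vertices with $k$ colors such that every edge contains a vertex of each color. $H_{\ge m}$ is obtained from $H$ by deleting all edges of size less than $m$. For a hypergraph family $\mathcal{H}$, $m_{\mathcal{H}}(k)$ is the smallest positive integer $m$ such that $H_{\ge m}$ has a polychromatic $k$-coloring for every $H\in\mathcal{H}$ ($\infty$ if none exists). *)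

theory Defs
  imports Complex_Main "HOL-Library.Extended_Nat"
begin

definition hypergraph :: "'a set \<times> 'a set set \<Rightarrow> bool" where
  "hypergraph H \<longleftrightarrow> (case H of (V, E) \<Rightarrow> E \<subseteq> Pow V)"

text \<open>Edges of size at least \<open>m\<close>. Sizes are measured by \<^const>\<open>card\<close>, so this is only
  meaningful for hypergraphs with finite edges; all families below have finite vertex sets.\<close>

definition restrict_size :: "'a set \<times> 'a set set \<Rightarrow> nat \<Rightarrow> 'a set \<times> 'a set set" where
  "restrict_size H m = (case H of (V, E) \<Rightarrow> (V, {e \<in> E. m \<le> card e}))"

text \<open>The colors are \<open>0, \<dots>, k - 1\<close>; the values of \<open>c\<close> outside the vertex set are irrelevant.\<close>

definition polychromatic_coloring ::
    "'a set \<times> 'a set set \<Rightarrow> nat \<Rightarrow> ('a \<Rightarrow> nat) \<Rightarrow> bool" where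
  "polychromatic_coloring H k c \<longleftrightarrow>
     (case H of (V, E) \<Rightarrow>
        (\<forall>v\<in>V. c v < k) \<and> (\<forall>e\<in>E. \<forall>i<k. \<exists>v\<in>e. c v = i))"

definition has_polychromatic_coloring :: "'a set \<times> 'a set set \<Rightarrow> nat \<Rightarrow> bool" where
  "has_polychromatic_coloring H k \<longleftrightarrow> (\<exists>c. polychromatic_coloring H k c)"

definition poly_threshold :: "('a set \<times> 'a set set) set \<Rightarrow> nat \<Rightarrow> enat" where
  "poly_threshold \<H> k =
     (if \<exists>m>0. \<forall>H\<in>\<H>. has_polychromatic_coloring (restrict_size H m) k
      then enat (LEAST m. 0 < m \<and> (\<forall>H\<in>\<H>. has_polychromatic_coloring (restrict_size H m) k))
      else \<infinity>)"

text \<open>The bounds are arbitrary reals, so the empty set counts as a (degenerate) strip.\<close>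

definition axis_parallel_strip :: "(real \<times> real) set \<Rightarrow> bool" where
  "axis_parallel_strip A \<longleftrightarrow>
     (\<exists>x0 x1. A = {(x, y). x0 < x \<and> x < x1}) \<or>
     (\<exists>y0 y1. A = {(x, y). y0 < y \<and> y < y1})"

definition strip_family :: "((real \<times> real) set \<times> (real \<times> real) set set) set" where
  "strip_family =
     {(V, E). hypergraph (V, E) \<and> finite V \<and>
        (\<forall>e\<in>E. \<exists>A. axis_parallel_strip A \<and> e = V \<inter> A)}"

text \<open>The \<open>s\<close> strips need not be distinct.\<close>

definition strip_union_family ::
    "nat \<Rightarrow> ((real \<times> real) set \<times> (real \<times> real) set set) set" where
  "strip_union_family s =
     {(V, E). hypergraph (V, E) \<and> finite V \<and>
        (\<forall>e\<in>E. \<exists>A. (\<forall>i\<in>{1..s}. axis_parallel_strip (A i)) \<and> e = V \<inter> (\<Union>i\<in>{1..s}. A i))}"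

end

theory Submission imports Defs begin

text \<open>Upper bound: by pigeonhole, an edge with more than \<open>s (m - 1)\<close> points in a union of
  \<open>s\<close> strips has at least \<open>m\<close> points in one of them. Lower bound: if a strip hypergraph admits
  no polychromatic \<open>k\<close>-coloring on its edges of size at least \<open>n\<close>, place \<open>(s - 1) k + 1\<close>
  translated copies of it along the diagonal, so far apart that a strip can be trimmed to meet
  only one copy. In any coloring with \<open>k\<close> colors, each copy has an edge of size at least \<open>n\<close>
  missing a color, and some \<open>s\<close> copies miss the same color; the union of these \<open>s\<close>
  disjoint edges has size at least \<open>s n\<close>.\<close>

definition family_colorable :: "('a set \<times> 'a set set) set \<Rightarrow> nat \<Rightarrow> nat \<Rightarrow> bool" where
  "family_colorable \<H> k m \<longleftrightarrow> (\<forall>H\<in>\<H>. has_polychromatic_coloring (restrict_size H m) k)"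

lemma poly_threshold_eq_enat:
  assumes "0 < m" and "family_colorable \<H> k m"
    and "\<And>t. 0 < t \<Longrightarrow> family_colorable \<H> k t \<Longrightarrow> m \<le> t"
  shows "poly_threshold \<H> k = enat m"
proof -
  have "(LEAST m. 0 < m \<and> family_colorable \<H> k m) = m"
    using assms by (intro Least_equality) auto
  then show ?thesis
    using assms(1,2) unfolding poly_threshold_def family_colorable_def by auto
qed

lemma poly_threshold_eq_infinity:
  assumes "\<And>t. 0 < t \<Longrightarrow> \<not> family_colorable \<H> k t"
  shows "poly_threshold \<H> k = \<infinity>"
  using assms unfolding poly_threshold_def family_colorable_def by auto

text \<open>The size of a union is at most the sum of the sizes. Applied to the traces of
  \<open>s\<close> strips on an edge, and to the classes of copies missing the same color.\<close>

lemma pigeonhole_UN: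
  assumes "finite I" and "card I * b < card (\<Union>i\<in>I. F i)"
  obtains i where "i \<in> I" and "b < card (F i)"
proof -
  have "\<exists>i\<in>I. b < card (F i)"
  proof (rule ccontr)
    assume "\<not> (\<exists>i\<in>I. b < card (F i))"
    then have "(\<Sum>i\<in>I. card (F i)) \<le> card I * b"
      using sum_bounded_above[of I "\<lambda>i. card (F i)" b] by (auto simp: not_less)
    with card_UN_le[OF assms(1), of F] assms(2) show False by linarith
  qed
  then show thesis using that by blast
qed

lemma strip_union_colorable:
  assumes "0 < m" and col: "family_colorable strip_family k m"
  shows "family_colorable (strip_union_family s) k (s * (m - 1) + 1)"
  unfolding family_colorable_def
proof clarify
  fix V :: "(real \<times> real) set" and E
  assume "(V, E) \<in> strip_union_family s"
  then have fin: "finite V"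
    and edge: "\<And>e. e \<in> E \<Longrightarrow> \<exists>A. (\<forall>i\<in>{1..s}. axis_parallel_strip (A i)) \<and> e = V \<inter> (\<Union>i\<in>{1..s}. A i)"
    unfolding strip_union_family_def by auto
  \<comment> \<open>With all strip traces on \<open>V\<close> as edges, a single coloring
    \<open>c\<close> serves every edge of \<open>E\<close>, whichever strips make it up.\<close>
  define E' where "E' = {V \<inter> A |A. axis_parallel_strip A}"
  have "(V, E') \<in> strip_family"
    using fin unfolding strip_family_def hypergraph_def E'_def by auto
  then obtain c where c: "polychromatic_coloring (restrict_size (V, E') m) k c"
    using col unfolding family_colorable_def has_polychromatic_coloring_def by blast
  have "\<exists>v\<in>e. c v = j" if e: "e \<in> E" "s * (m - 1) + 1 \<le> card e" and "j < k" for e j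
  proof -
    obtain A where A: "\<forall>i\<in>{1..s}. axis_parallel_strip (A i)" "e = V \<inter> (\<Union>i\<in>{1..s}. A i)"
      using edge[OF e(1)] by blast
    have "e = (\<Union>i\<in>{1..s}. V \<inter> A i)" using A(2) by auto
    \<comment> \<open>\<open>s * (m - 1) + 1\<close> is the least size that \<open>s\<close> sets of
      at most \<open>m - 1\<close> points each cannot cover.\<close>
    with e(2) have "card {1..s} * (m - 1) < card (\<Union>i\<in>{1..s}. V \<inter> A i)" by simp
    then obtain i where i: "i \<in> {1..s}" "m - 1 < card (V \<inter> A i)"
      by (rule pigeonhole_UN[rotated]) auto
    have "V \<inter> A i \<in> E'" "m \<le> card (V \<inter> A i)"
      using A(1) i unfolding E'_def by auto
    then have "\<exists>v\<in>V \<inter> A i. c v = j"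
      using c \<open>j < k\<close> unfolding polychromatic_coloring_def restrict_size_def by simp
    then show ?thesis using A(2) i(1) by blast
  qed
  then have "polychromatic_coloring (restrict_size (V, E) (s * (m - 1) + 1)) k c"
    using c unfolding polychromatic_coloring_def restrict_size_def by auto
  then show "has_polychromatic_coloring (restrict_size (V, E) (s * (m - 1) + 1)) k"
    unfolding has_polychromatic_coloring_def by blast
qed

text \<open>\<open>2 * B\<close> is the side of an open square around the origin that will contain
  \<open>V\<close>. Moving both coordinates keeps the projections of different copies disjoint on
  both axes, so vertical and horizontal strips can both be confined to one copy.\<close>

definition diag_shift :: "real \<Rightarrow> nat \<Rightarrow> real \<times> real \<Rightarrow> real \<times> real" where
  "diag_shift B i p = (fst p + real i * (2 * B), snd p + real i * (2 * B))"

lemma inj_diag_shift: "inj (diag_shift B i)"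
  by (auto simp: inj_def diag_shift_def prod_eq_iff)

text \<open>Two points of an open interval of length \<open>2 * B\<close> differ by less than
  \<open>2 * B\<close>, so the integer \<open>j - i\<close> has absolute value below 1.\<close>

lemma shifted_in_window_imp_eq:
  fixes B x :: real and i j :: nat
  assumes "\<bar>x\<bar> < B" and "\<bar>x + real j * (2 * B) - real i * (2 * B)\<bar> < B"
  shows "i = j"
proof -
  have "B > 0" using assms(1) by linarith
  have "x + real j * (2 * B) - real i * (2 * B) = x + (real j - real i) * (2 * B)"
    by (simp add: algebra_simps)
  then have "\<bar>(real j - real i) * (2 * B)\<bar> < 1 * (2 * B)" using assms by linarith
  then have "\<bar>real j - real i\<bar> < 1"
    using \<open>B > 0\<close> by (simp add: abs_mult)
  then show ?thesis by linarith
qed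

text \<open>The witness is \<open>A\<close> moved along with copy \<open>i\<close> and cut down to
  the window of width \<open>2 * B\<close> that contains this copy.\<close>

lemma trimmed_strip:
  assumes "axis_parallel_strip A"
    and bound: "\<And>p. p \<in> V \<Longrightarrow> \<bar>fst p\<bar> < B \<and> \<bar>snd p\<bar> < B"
  shows "\<exists>A'. axis_parallel_strip A' \<and>
    (\<forall>j. \<forall>p\<in>V. diag_shift B j p \<in> A' \<longleftrightarrow> j = i \<and> p \<in> A)"
proof -
  \<comment> \<open>One coordinate at a time: \<open>max\<close> and \<open>min\<close> do the
    trimming, which removes no point of copy \<open>i\<close> because its unshifted coordinates lie
    strictly between \<open>- B\<close> and \<open>B\<close>.\<close>
  have window: "max l (- B) + real i * (2 * B) < x + real j * (2 * B) \<and>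
      x + real j * (2 * B) < min u B + real i * (2 * B) \<longleftrightarrow> j = i \<and> l < x \<and> x < u"
    if "\<bar>x\<bar> < B" for x l u and j :: nat
  proof
    assume *: "max l (- B) + real i * (2 * B) < x + real j * (2 * B) \<and>
      x + real j * (2 * B) < min u B + real i * (2 * B)"
    then have "\<bar>x + real j * (2 * B) - real i * (2 * B)\<bar> < B" by linarith
    with that have "i = j" by (rule shifted_in_window_imp_eq)
    with * show "j = i \<and> l < x \<and> x < u" by simp
  qed (use that in \<open>simp add: abs_less_iff\<close>)
  from assms(1) consider
      (vertical) l u where "A = {(x, y). l < x \<and> x < u}"
    | (horizontal) l u where "A = {(x, y). l < y \<and> y < u}"
    unfolding axis_parallel_strip_def by blast
  then show ?thesis
  proof cases
    case vertical
    let ?A = "{(x, y :: real). max l (- B) + real i * (2 * B) < x \<and> x < min u B + real i * (2 * B)}"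
    have "diag_shift B j p \<in> ?A \<longleftrightarrow> j = i \<and> p \<in> A" if "p \<in> V" for j p
      using window[of "fst p" l j u] bound[OF that]
      by (simp only: diag_shift_def vertical mem_Collect_eq case_prod_unfold fst_conv)
    moreover have "axis_parallel_strip ?A" unfolding axis_parallel_strip_def by blast
    ultimately show ?thesis by (intro exI[of _ ?A] conjI allI ballI)
  next
    case horizontal
    let ?A = "{(x :: real, y). max l (- B) + real i * (2 * B) < y \<and> y < min u B + real i * (2 * B)}"
    have "diag_shift B j p \<in> ?A \<longleftrightarrow> j = i \<and> p \<in> A" if "p \<in> V" for j p
      using window[of "snd p" l j u] bound[OF that]
      by (simp only: diag_shift_def horizontal mem_Collect_eq case_prod_unfold snd_conv)
    moreover have "axis_parallel_strip ?A" unfolding axis_parallel_strip_def by blast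
    ultimately show ?thesis by (intro exI[of _ ?A] conjI allI ballI)
  qed
qed

text \<open>Serves both cases of the theorem: \<open>n\<close> is one less than the strip threshold
  if that is finite, and \<open>n = t\<close> otherwise.\<close>

lemma strip_union_not_colorable:
  assumes "0 < s" and notcol: "\<not> family_colorable strip_family k n" and "t \<le> s * n"
  shows "\<not> family_colorable (strip_union_family s) k t"
proof
  assume union_col: "family_colorable (strip_union_family s) k t"
  obtain V E where VE: "(V, E) \<in> strip_family"
    and bad: "\<not> has_polychromatic_coloring (restrict_size (V, E) n) k"
    using notcol unfolding family_colorable_def by auto
  have fin: "finite V" and edge: "\<And>e. e \<in> E \<Longrightarrow> \<exists>A. axis_parallel_strip A \<and> e = V \<inter> A"
    using VE unfolding strip_family_def by auto
  \<comment> \<open>The sum of nonnegative terms dominates each coordinate; the added 1 makes the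
    bound strict.\<close>
  define B where "B = 1 + (\<Sum>p\<in>V. \<bar>fst p\<bar> + \<bar>snd p\<bar>)"
  have bound: "\<bar>fst p\<bar> < B \<and> \<bar>snd p\<bar> < B" if "p \<in> V" for p
    using member_le_sum[OF that _ fin, of "\<lambda>p. \<bar>fst p\<bar> + \<bar>snd p\<bar>"]
    unfolding B_def by auto
  define N where "N = k * (s - 1) + 1"
  define W where "W = (\<Union>i<N. diag_shift B i ` V)"
  define F where "F = {W \<inter> (\<Union>i\<in>{1..s}. A i) |A. \<forall>i\<in>{1..s}. axis_parallel_strip (A i)}"
  have "(W, F) \<in> strip_union_family s"
    using fin unfolding strip_union_family_def hypergraph_def F_def W_def by auto
  then obtain c where c: "polychromatic_coloring (restrict_size (W, F) t) k c"
    using union_col unfolding family_colorable_def has_polychromatic_coloring_def by blast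
  have c_lt: "c v < k" if "v \<in> W" for v
    using c that unfolding polychromatic_coloring_def restrict_size_def by simp
  have "\<exists>e j. e \<in> E \<and> n \<le> card e \<and> j < k \<and> (\<forall>v\<in>e. c (diag_shift B i v) \<noteq> j)"
    if "i < N" for i
  proof -
    \<comment> \<open>Pulled back to \<open>V\<close> along the shift, \<open>c\<close> uses only
      colors below \<open>k\<close>, so it can fail only by missing a color on a large edge.\<close>
    have "\<forall>v\<in>V. c (diag_shift B i v) < k" using c_lt that unfolding W_def by blast
    moreover have "\<not> polychromatic_coloring (restrict_size (V, E) n) k (\<lambda>v. c (diag_shift B i v))"
      using bad unfolding has_polychromatic_coloring_def by blast
    ultimately show ?thesis
      unfolding polychromatic_coloring_def restrict_size_def by auto
  qed
  then obtain e col where e: "\<And>i. i < N \<Longrightarrow> e i \<in> E \<and> n \<le> card (e i) \<and> col i < k \<and>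
      (\<forall>v\<in>e i. c (diag_shift B i v) \<noteq> col i)"
    by metis
  \<comment> \<open>The copies are sorted by their missing color; since \<open>N\<close> exceeds
    \<open>k * (s - 1)\<close>, one of the \<open>k\<close> classes has at least \<open>s\<close>
    members.\<close>
  have "(\<Union>j\<in>{..<k}. {i. i < N \<and> col i = j}) = {..<N}" using e by auto
  then have "card {..<k} * (s - 1) < card (\<Union>j\<in>{..<k}. {i. i < N \<and> col i = j})"
    by (simp add: N_def)
  then obtain j where j: "j < k" "s - 1 < card {i. i < N \<and> col i = j}"
    by (rule pigeonhole_UN[rotated]) auto
  then have "s \<le> card {i. i < N \<and> col i = j}" by linarith
  then obtain I where I: "I \<subseteq> {i. i < N \<and> col i = j}" "card I = s" "finite I"
    by (rule obtain_subset_with_card_n)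
  \<comment> \<open>\<open>h\<close> renumbers the chosen copies by \<open>{1..s}\<close>, the index
    set in the definition of \<open>strip_union_family\<close>.\<close>
  then obtain h where h: "bij_betw h {1..s} I"
    using ex_bij_betw_nat_finite_1 by blast
  have "\<exists>A. axis_parallel_strip A \<and> (\<forall>j. \<forall>p\<in>V. diag_shift B j p \<in> A \<longleftrightarrow> j = i \<and> p \<in> e i)"
    if i: "i < N" for i
  proof -
    obtain A where A: "axis_parallel_strip A" "e i = V \<inter> A" using edge e[OF i] by blast
    show ?thesis using trimmed_strip[OF A(1) bound, where i = i] A(2) by auto
  qed
  then obtain A where A: "\<And>i. i < N \<Longrightarrow> axis_parallel_strip (A i)"
    "\<And>i j p. i < N \<Longrightarrow> p \<in> V \<Longrightarrow> diag_shift B j p \<in> A i \<longleftrightarrow> j = i \<and> p \<in> e i"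
    by metis
  have eV: "e i \<subseteq> V" if "i < N" for i using edge e that by blast
  define X where "X = W \<inter> (\<Union>i\<in>I. A i)"
  have IN: "i < N" "col i = j" if "i \<in> I" for i using I(1) that by auto
  have WA: "W \<inter> A i = diag_shift B i ` e i" if i: "i < N" for i
  proof (intro equalityI subsetI)
    fix v assume "v \<in> W \<inter> A i"
    then obtain j p where "p \<in> V" "v = diag_shift B j p" "v \<in> A i" unfolding W_def by auto
    with A(2)[OF i, of p j] show "v \<in> diag_shift B i ` e i" by simp
  next
    fix v assume "v \<in> diag_shift B i ` e i"
    then obtain p where p: "p \<in> e i" "p \<in> V" "v = diag_shift B i p" using eV[OF i] by auto
    with A(2)[OF i, of p i] have "v \<in> A i" by simp
    moreover have "v \<in> W" using p(2,3) i unfolding W_def by auto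
    ultimately show "v \<in> W \<inter> A i" by simp
  qed
  then have X: "X = (\<Union>i\<in>I. diag_shift B i ` e i)"
    using IN unfolding X_def by blast
  have "W \<inter> (\<Union>i\<in>{1..s}. A (h i)) \<in> F"
  proof -
    have "\<forall>i\<in>{1..s}. axis_parallel_strip (A (h i))"
      using A(1) IN h unfolding bij_betw_def by blast
    then show ?thesis unfolding F_def by (intro CollectI exI[of _ "\<lambda>i. A (h i)"]) simp
  qed
  moreover have "(\<Union>i\<in>{1..s}. A (h i)) = (\<Union>i\<in>I. A i)"
    using h unfolding bij_betw_def by auto
  ultimately have XF: "X \<in> F" unfolding X_def by simp
  have disj: "diag_shift B i ` e i \<inter> diag_shift B i' ` e i' = {}"
    if "i \<in> I" "i' \<in> I" "i \<noteq> i'" for i i'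
  proof -
    have "diag_shift B i p \<notin> A i'" if "p \<in> e i" for p
      using A(2)[of i' p i] eV[of i] IN(1) \<open>i \<in> I\<close> \<open>i' \<in> I\<close> \<open>i \<noteq> i'\<close> that by auto
    then show ?thesis using WA[of i'] IN[OF that(2)] by blast
  qed
  \<comment> \<open>The chosen edges lie in distinct copies and shifts are injective, so their sizes
    add up and \<open>X\<close> survives the size restriction.\<close>
  have "card X = (\<Sum>i\<in>I. card (diag_shift B i ` e i))"
    unfolding X
    by (intro card_UN_disjoint I(3) ballI impI disj finite_imageI finite_subset[OF eV fin] IN(1))
  also have "\<dots> = (\<Sum>i\<in>I. card (e i))"
    by (simp add: card_image inj_on_subset[OF inj_diag_shift])
  also have "\<dots> \<ge> s * n"
    using sum_bounded_below[of I n "\<lambda>i. card (e i)"] e IN I(2) by simp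
  finally have "t \<le> card X" using \<open>t \<le> s * n\<close> by linarith
  with XF c j(1) have "\<exists>v\<in>X. c v = j"
    unfolding polychromatic_coloring_def restrict_size_def by simp
  \<comment> \<open>The point of color \<open>j\<close> in \<open>X\<close> comes from some
    \<open>e i\<close> with \<open>i\<close> in \<open>I\<close>, whose missing color is
    \<open>j\<close> itself.\<close>
  then obtain i v where "i \<in> I" "v \<in> e i" "c (diag_shift B i v) = j"
    unfolding X by auto
  then show False using e[OF IN(1)] IN(2) by simp
qed

theorem theorem5:
  fixes s k :: nat
  assumes "0 < s" and "0 < k"
  shows "poly_threshold (strip_union_family s) k
           = enat s * poly_threshold strip_family k - enat s + 1"
proof (cases "\<exists>m>0. family_colorable strip_family k m")
  case True
  define m where "m = (LEAST m. 0 < m \<and> family_colorable strip_family k m)"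
  have m: "0 < m" "family_colorable strip_family k m"
    using LeastI_ex[OF True] unfolding m_def by auto
  have least: "m \<le> t" if "0 < t" "family_colorable strip_family k t" for t
    unfolding m_def using that by (auto intro: Least_le)
  have "poly_threshold strip_family k = enat m"
    using m least by (rule poly_threshold_eq_enat)
  moreover have "poly_threshold (strip_union_family s) k = enat (s * (m - 1) + 1)"
  proof (rule poly_threshold_eq_enat)
    show "family_colorable (strip_union_family s) k (s * (m - 1) + 1)"
      using m by (rule strip_union_colorable)
    fix t assume t: "0 < t" "family_colorable (strip_union_family s) k t"
    show "s * (m - 1) + 1 \<le> t"
    proof (rule ccontr)
      assume "\<not> s * (m - 1) + 1 \<le> t"
      then have le: "t \<le> s * (m - 1)" by simp
      \<comment> \<open>Positivity of \<open>t\<close> excludes \<open>m = 1\<close>, so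
        \<open>m - 1\<close> is a positive candidate below \<open>m\<close> and minimality applies
        to it.\<close>
      with t(1) have "0 < m - 1" by (cases "m - 1") auto
      then have "\<not> family_colorable strip_family k (m - 1)"
        using least[of "m - 1"] by auto
      then show False using strip_union_not_colorable[OF assms(1) _ le] t(2) by blast
    qed
  qed simp
  ultimately show ?thesis
    by (simp add: one_enat_def diff_mult_distrib2)
next
  case False
  have "\<not> family_colorable (strip_union_family s) k t" if "0 < t" for t
  proof (rule strip_union_not_colorable)
    show "\<not> family_colorable strip_family k t" using False that by blast
    show "t \<le> s * t" using assms(1) by simp
  qed fact
  then have "poly_threshold (strip_union_family s) k = \<infinity>"
    by (rule poly_threshold_eq_infinity)
  moreover have "poly_threshold strip_family k = \<infinity>"
    using False by (blast intro: poly_threshold_eq_infinity)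
  \<comment> \<open>Positivity of \<open>s\<close> matters: in \<open>enat\<close>, zero times
    infinity is 0.\<close>
  ultimately show ?thesis using assms(1) by (simp add: enat_0_iff)
qed

end
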